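(* If $x\in\mathfrak{F}_{\mathbb{R}}$ is of rank 2, then it is of rank 1. (As the rank conditions in the context are mutually exclusive, this means that $\mathfrak{F}_{\mathbb{R}}$ has no elements of rank 2.)
   Context: Jordan algebra. $\mathfrak{J}_{\mathbb{R}}=\mathbb{R}$ with cubic norm $N(A)=A^3$, base point $1$, trace bilinear form $\mathrm{Tr}(A,B)=3AB$ and quadratic adjoint $A^\sharp=A^2$. Freudenthal triple system. $\mathfrak{F}_{\mathbb{R}}=\mathfrak{F}(\mathfrak{J}_{\mathbb{R}})=\mathbb{R}\oplus\mathbb{R}\oplus\mathfrak{J}_{\mathbb{R}}\oplus\mathfrak{J}_{\mathbb{R}}$, with elements written $x=\begin{pmatrix}\alpha & A \\ B & \beta\end{pmatrix}$, $\alpha,\beta,A,B\in\mathbb{R}$. For $y=\begin{pmatrix}\gamma & C \\ D & \delta\end{pmatrix}$, the antisymmetric bilinear form is $$\{x,y\}=\alpha\delta-\beta\gamma+\mathrm{Tr}(A,D)-\mathrm{Tr}(B,C),$$ and the quartic form is $$\Delta(x)=-(\alpha\beta-\mathrm{Tr}(A,B))^2-4[\alpha N(A)+\beta N(B)-\mathrm{Tr}(A^\sharp,B^\sharp)].$$ Let $\Delta(x,y,w,z)$ be its full symmetric linearization, normalized by $\Delta(x,x,x,x)=\Delta(x)$. The triple product $T$ is defined by $\{T(x,y,w),z\}=2\Delta(x,y,w,z)$ for all $z$, and $T(x):=T(x,x,x)$. Put $\Upsilon(x,x,y)=3T(x,x,y)+\{x,y\}x$. Rank. A non-zero $x$ has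 rank 1 iff $\Upsilon(x,x,y)=0$ for all $y$; rank 2 iff $T(x)=0$ and $\Upsilon(x,x,y)\neq0$ for some $y$; rank 3 iff $\Delta(x)=0$ and $T(x)\neq0$; rank 4 iff $\Delta(x)\ne0$. *)

theory Defs
  imports "HOL-Analysis.Product_Vector"
begin

section \<open>The cubic Jordan algebra of the reals\<close>

definition jordan_norm :: "real \<Rightarrow> real"
  where "jordan_norm A = A ^ 3"

definition jordan_trace :: "real \<Rightarrow> real \<Rightarrow> real"
  where "jordan_trace A B = 3 * A * B"

definition jordan_sharp :: "real \<Rightarrow> real"
  where "jordan_sharp A = A\<^sup>2"

section \<open>The Freudenthal triple system\<close>

text \<open>
  A tuple \<open>(\<alpha>, \<beta>, A, B)\<close> stands for the matrix with rows \<open>\<alpha> A\<close> and \<open>B \<beta>\<close>.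
  The vector space structure is the one of the product type.
\<close>

type_synonym fts = "real \<times> real \<times> real \<times> real"

fun fts_form :: "fts \<Rightarrow> fts \<Rightarrow> real"
  where "fts_form (\<alpha>, \<beta>, A, B) (\<gamma>, \<delta>, C, D) =
    \<alpha> * \<delta> - \<beta> * \<gamma> + jordan_trace A D - jordan_trace B C"

fun fts_quartic :: "fts \<Rightarrow> real"
  where "fts_quartic (\<alpha>, \<beta>, A, B) =
    - (\<alpha> * \<beta> - jordan_trace A B)\<^sup>2
    - 4 * (\<alpha> * jordan_norm A + \<beta> * jordan_norm B
           - jordan_trace (jordan_sharp A) (jordan_sharp B))"

text \<open>
  The full symmetric linearization of the quartic form, given by the polarization formula
  (the alternating sum over the nonempty subsets of the four arguments, divided by 4!).
  The lemmas below show that it is the unique symmetric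
  4-linear form whose restriction to the diagonal is the quartic form.
\<close>

definition fts_quartic_lin :: "fts \<Rightarrow> fts \<Rightarrow> fts \<Rightarrow> fts \<Rightarrow> real"
  where "fts_quartic_lin x y w z =
    (fts_quartic (x + y + w + z)
     - fts_quartic (x + y + w) - fts_quartic (x + y + z)
     - fts_quartic (x + w + z) - fts_quartic (y + w + z)
     + fts_quartic (x + y) + fts_quartic (x + w) + fts_quartic (x + z)
     + fts_quartic (y + w) + fts_quartic (y + z) + fts_quartic (w + z)
     - fts_quartic x - fts_quartic y - fts_quartic w - fts_quartic z) / 24"

lemma fts_quartic_lin_diag: "fts_quartic_lin x x x x = fts_quartic x"
proof (cases x)
  case (fields a b A B)
  show ?thesis
    unfolding fields fts_quartic_lin_def add_Pair fts_quartic.simps jordan_norm_def jordan_trace_def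
      jordan_sharp_def
    by algebra
qed

lemma fts_quartic_lin_sym:
  "fts_quartic_lin y x w z = fts_quartic_lin x y w z"
  "fts_quartic_lin x w y z = fts_quartic_lin x y w z"
  "fts_quartic_lin x y z w = fts_quartic_lin x y w z"
  by (simp_all add: fts_quartic_lin_def add_ac)

lemma fts_quartic_lin_expand:
  "fts_quartic_lin (a1, b1, A1, B1) (a2, b2, A2, B2) (a3, b3, A3, B3) (a4, b4, A4, B4) =
     (a4 * (3 * (b1*(A2*B3 + A3*B2) + b2*(A1*B3 + A3*B1) + b3*(A1*B2 + A2*B1))
            - 2 * (a1*b2*b3 + a2*b1*b3 + a3*b1*b2) - 12 * A1*A2*A3)
    + b4 * (3 * (a1*(A2*B3 + A3*B2) + a2*(A1*B3 + A3*B1) + a3*(A1*B2 + A2*B1))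
            - 2 * (b1*a2*a3 + b2*a1*a3 + b3*a1*a2) - 12 * B1*B2*B3)
    + A4 * (3 * (a1*(b2*B3 + b3*B2) + a2*(b1*B3 + b3*B1) + a3*(b1*B2 + b2*B1))
            + 6 * (A1*B2*B3 + A2*B1*B3 + A3*B1*B2)
            - 12 * (a1*A2*A3 + a2*A1*A3 + a3*A1*A2))
    + B4 * (3 * (a1*(b2*A3 + b3*A2) + a2*(b1*A3 + b3*A1) + a3*(b1*A2 + b2*A1))
            + 6 * (B1*A2*A3 + B2*A1*A3 + B3*A1*A2)
            - 12 * (b1*B2*B3 + b2*B1*B3 + b3*B1*B2))) / 12"
proof -
  have *: "p / 24 = q / 12" if "p = 2 * q" for p q :: real
    using that by simp
  show ?thesis
    unfolding fts_quartic_lin_def add_Pair fts_quartic.simps jordan_norm_def jordan_trace_def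
      jordan_sharp_def
    by (rule *) algebra
qed

lemma fts_quartic_lin_coeffs:
  obtains p q r s where
    "\<And>a b A B. fts_quartic_lin x y w (a, b, A, B) = p * a + q * b + r * A + s * B"
proof (cases x; cases y; cases w)
  fix a1 b1 A1 B1 a2 b2 A2 B2 a3 b3 A3 B3
  assume xyw: "x = (a1, b1, A1, B1)" "y = (a2, b2, A2, B2)" "w = (a3, b3, A3, B3)"
  have *: "(a * p + b * q + A * r + B * s) / 12 = p / 12 * a + q / 12 * b + r / 12 * A + s / 12 * B"
    for a b A B p q r s :: real
    by (simp add: add_divide_distrib mult.commute)
  show thesis
    by (rule that) (unfold xyw fts_quartic_lin_expand, rule *)
qed

lemma fts_quartic_lin_linear: "linear (fts_quartic_lin x y w)"
proof -
  obtain p q r s where *: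
    "\<And>a b A B. fts_quartic_lin x y w (a, b, A, B) = p * a + q * b + r * A + s * B"
    using fts_quartic_lin_coeffs by blast
  show ?thesis
    by (rule linearI) (auto simp: * algebra_simps)
qed

lemma fts_quartic_lin_unique:
  fixes F :: "fts \<Rightarrow> fts \<Rightarrow> fts \<Rightarrow> fts \<Rightarrow> real"
  assumes sym: "\<And>x y w z. F y x w z = F x y w z" "\<And>x y w z. F x w y z = F x y w z"
      "\<And>x y w z. F x y z w = F x y w z"
    and lin: "\<And>x y w. linear (F x y w)"
    and diag: "\<And>x. F x x x x = fts_quartic x"
  shows "F = fts_quartic_lin"
proof -
  have a4: "F x y w (u + v) = F x y w u + F x y w v" for x y w u v
    by (rule linear_add[OF lin])
  have a3: "F x y (u + v) w = F x y u w + F x y v w" for x y w u v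
    by (metis a4 sym(3))
  have a2: "F x (u + v) y w = F x u y w + F x v y w" for x y w u v
    by (metis a3 sym(2))
  have a1: "F (u + v) x y w = F u x y w + F v x y w" for x y w u v
    by (metis a2 sym(1))
  show ?thesis
  proof (intro ext)
    fix x y w z
    have *: "a = b / 24" if "24 * a = b" for a b :: real
      using that by simp
    show "F x y w z = fts_quartic_lin x y w z"
      by (simp only: fts_quartic_lin_def diag[symmetric] a1 a2 a3 a4 sym, rule *, algebra)
  qed
qed

text \<open>The triple product, determined by nondegeneracy of the bilinear form.\<close>

definition fts_triple :: "fts \<Rightarrow> fts \<Rightarrow> fts \<Rightarrow> fts"
  where "fts_triple x y w =
    (THE t. \<forall>z. fts_form t z = 2 * fts_quartic_lin x y w z)"

lemma fts_triple_ex1: "\<exists>!t. \<forall>z. fts_form t z = 2 * fts_quartic_lin x y w z"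
proof -
  obtain p q r s where *:
    "\<And>a b A B. fts_quartic_lin x y w (a, b, A, B) = p * a + q * b + r * A + s * B"
    using fts_quartic_lin_coeffs by blast
  let ?f = "\<lambda>z. 2 * fts_quartic_lin x y w z"
  define t :: fts where "t = (2 * q, - 2 * p, 2 * s / 3, - 2 * r / 3)"
  have "fts_form t z = ?f z" for z
    by (cases z) (simp add: t_def * jordan_trace_def)
  moreover have "u = t" if "\<forall>z. fts_form u z = ?f z" for u
  proof (cases u)
    case (fields a b A B)
    have "fts_form u (0,1,0,0) = ?f (0,1,0,0)" "fts_form u (1,0,0,0) = ?f (1,0,0,0)"
      "fts_form u (0,0,0,1) = ?f (0,0,0,1)" "fts_form u (0,0,1,0) = ?f (0,0,1,0)"
      using that by blast+
    then show ?thesis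
      by (auto simp: fields t_def * jordan_trace_def)
  qed
  ultimately show ?thesis by blast
qed

lemma fts_form_triple: "fts_form (fts_triple x y w) z = 2 * fts_quartic_lin x y w z"
  using theI'[OF fts_triple_ex1[of x y w]] unfolding fts_triple_def by blast

definition fts_cubic :: "fts \<Rightarrow> fts"
  where "fts_cubic x = fts_triple x x x"

text \<open>\<open>fts_Upsilon x y\<close> stands for \<open>\<Upsilon>(x, x, y)\<close>.\<close>

definition fts_Upsilon :: "fts \<Rightarrow> fts \<Rightarrow> fts"
  where "fts_Upsilon x y = 3 *\<^sub>R fts_triple x x y + fts_form x y *\<^sub>R x"

definition fts_rank1 :: "fts \<Rightarrow> bool"
  where "fts_rank1 x \<longleftrightarrow> x \<noteq> 0 \<and> (\<forall>y. fts_Upsilon x y = 0)"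

definition fts_rank2 :: "fts \<Rightarrow> bool"
  where "fts_rank2 x \<longleftrightarrow> x \<noteq> 0 \<and> fts_cubic x = 0 \<and> (\<exists>y. fts_Upsilon x y \<noteq> 0)"

end

theory Submission
  imports Defs
begin

text \<open>
  Read \<open>x = (a, b, A, B)\<close> as the binary cubic \<open>a s\<^sup>3 + 3 B s\<^sup>2 t + 3 A s t\<^sup>2 + b t\<^sup>3\<close>. The quartic form
  is then the discriminant divided by 27, the cubic map \<open>T\<close> is the gradient of the quartic form,
  transported by the antisymmetric form and halved, and the coefficients of the Hessian of the
  cubic are, up to constants, the three \<open>2 \<times> 2\<close> minors (up to sign)
  \[ A^2 - b B, \quad B^2 - a A, \quad a b - A B \]
  of the matrix with rows \<open>a B A\<close> and \<open>B A b\<close>. These minors vanish exactly on the cone over the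
  twisted cubic, that is, on the cubes of linear forms.

  The theorem says that the discriminant hypersurface is singular only along that cone. Two
  computations show this. The square of each minor is a combination of entries of \<open>T(x)\<close> with
  coefficients linear in \<open>x\<close>; as the real numbers have no nilpotent elements, \<open>T(x) = 0\<close> forces
  all minors to vanish (\<open>minors_vanish\<close>). On the other hand, \<open>\<Upsilon>(x, x, y)\<close> is linear in the minors
  (\<open>fts_form_Upsilon\<close>). So \<open>T(x) = 0\<close> already implies \<open>\<Upsilon>(x, x, y) = 0\<close> for all \<open>y\<close>.
\<close>

lemma fts_form_nondegenerate:
  assumes "\<And>z. fts_form t z = 0"
  shows "t = 0"
proof (cases t)
  case (fields a b A B)
  show ?thesis
    using assms[of "(1,0,0,0)"] assms[of "(0,1,0,0)"] assms[of "(0,0,1,0)"] assms[of "(0,0,0,1)"]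
    by (simp add: fields jordan_trace_def zero_prod_def)
qed

lemma fts_form_lincomb_left:
  "fts_form (r *\<^sub>R t + s *\<^sub>R u) z = r * fts_form t z + s * fts_form u z"
  by (cases t; cases u; cases z) (simp add: jordan_trace_def algebra_simps)

text \<open>
  The entries of \<open>T(x)\<close> are recovered, up to nonzero factors, by pairing with the four coordinate
  vectors; they are the partial derivatives of the discriminant.
\<close>

lemma fts_cubic_zeroD:
  assumes "fts_cubic (a, b, A, B) = 0"
  shows "3 * b * A * B - a * b\<^sup>2 - 2 * A ^ 3 = 0"
    and "3 * a * A * B - b * a\<^sup>2 - 2 * B ^ 3 = 0"
    and "a * b * B + A * B\<^sup>2 - 2 * a * A\<^sup>2 = 0"
    and "a * b * A + A\<^sup>2 * B - 2 * b * B\<^sup>2 = 0"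
proof -
  let ?x = "(a, b, A, B)"
  have "fts_form (fts_cubic ?x) z = 0" for z
    by (cases z) (simp add: assms zero_prod_def jordan_trace_def)
  then have "fts_quartic_lin ?x ?x ?x z = 0" for z
    using fts_form_triple[of ?x ?x ?x z] by (simp add: fts_cubic_def)
  from this[of "(1,0,0,0)"] this[of "(0,1,0,0)"] this[of "(0,0,1,0)"] this[of "(0,0,0,1)"]
  show "3 * b * A * B - a * b\<^sup>2 - 2 * A ^ 3 = 0"
    and "3 * a * A * B - b * a\<^sup>2 - 2 * B ^ 3 = 0"
    and "a * b * B + A * B\<^sup>2 - 2 * a * A\<^sup>2 = 0"
    and "a * b * A + A\<^sup>2 * B - 2 * b * B\<^sup>2 = 0"
    unfolding fts_quartic_lin_expand
    by (simp_all add: power2_eq_square power3_eq_cube algebra_simps)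
qed

text \<open>
  The square of each minor is a combination of two of the partial derivatives, with linear
  coefficients. So the minors vanish, although the partial derivatives generate a smaller ideal.
\<close>

lemma minors_vanish:
  fixes a b A B :: real
  assumes "3 * b * A * B - a * b\<^sup>2 - 2 * A ^ 3 = 0" (is "?p = 0")
    and "3 * a * A * B - b * a\<^sup>2 - 2 * B ^ 3 = 0" (is "?q = 0")
    and "a * b * B + A * B\<^sup>2 - 2 * a * A\<^sup>2 = 0" (is "?r = 0")
    and "a * b * A + A\<^sup>2 * B - 2 * b * B\<^sup>2 = 0" (is "?s = 0")
  shows "A\<^sup>2 - b * B = 0" and "B\<^sup>2 - a * A = 0" and "a * b - A * B = 0"
proof -
  have "2 * (A\<^sup>2 - b * B)\<^sup>2 = - (A * ?p + b * ?s)"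
    and "2 * (B\<^sup>2 - a * A)\<^sup>2 = - (B * ?q + a * ?r)"
    and "(a * b - A * B)\<^sup>2 = A * ?r - a * ?p"
    by algebra+
  then show "A\<^sup>2 - b * B = 0" "B\<^sup>2 - a * A = 0" "a * b - A * B = 0"
    unfolding assms by simp_all
qed

text \<open>
  Pairing with \<open>z\<close> makes \<open>\<Upsilon>(x, x, y)\<close> a symmetric bilinear form in \<open>y\<close> and \<open>z\<close>. For \<open>y = z\<close> it is
  the part of \<open>\<Delta>(x + y)\<close> that is quadratic in \<open>y\<close>, plus \<open>{x, y}\<^sup>2\<close>; this square cancels all terms
  that are not multiples of a minor, such as \<open>b\<^sup>2 c\<^sup>2\<close>.
\<close>

lemma fts_form_Upsilon:
  "fts_form (fts_Upsilon (a, b, A, B) (c, d, C, D)) (e, f, E, F) =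
     (A\<^sup>2 - b * B) * (12 * D * F - 6 * (c * E + C * e))
     + (B\<^sup>2 - a * A) * (12 * C * E - 6 * (d * F + D * f))
     + (a * b - A * B) * (3 * (C * F + D * E) - 3 * (c * f + d * e))"
proof -
  have half: "3 * (2 * (p / 12)) + q = r" if "p + 2 * q = 2 * r" for p q r :: real
    using that by simp
  show ?thesis
    unfolding fts_Upsilon_def fts_form_lincomb_left fts_form_triple fts_quartic_lin_expand
      fts_form.simps jordan_trace_def
    by (rule half) algebra
qed

lemma fts_Upsilon_eq_0_if_fts_cubic_eq_0:
  assumes "fts_cubic x = 0"
  shows "fts_Upsilon x y = 0"
proof (rule fts_form_nondegenerate)
  fix z
  show "fts_form (fts_Upsilon x y) z = 0"
  proof (cases x; cases y; cases z)
    fix a b A B c d C D e f E F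
    assume xyz: "x = (a, b, A, B)" "y = (c, d, C, D)" "z = (e, f, E, F)"
    show ?thesis
      unfolding xyz fts_form_Upsilon minors_vanish[OF fts_cubic_zeroD[OF assms[unfolded xyz]]]
      by simp
  qed
qed

theorem lemma7:
  "(\<forall>x. fts_rank2 x \<longrightarrow> fts_rank1 x) \<and> \<not> (\<exists>x. fts_rank2 x)"
  using fts_Upsilon_eq_0_if_fts_cubic_eq_0 unfolding fts_rank2_def by blast

end
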